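(* Let $G$ be a $2$-edge-connected graph and let $C$ be a non-separating cycle of $G$ such that the contracted graph $G/E(C)$ admits a nowhere-zero $4$-flow. Then $G$ has a $5$-CDC $\mathcal S$ with $C \in \mathcal S$.
   Context: Graphs are finite and may have parallel edges and loops. A cycle is a graph (here a subgraph of $G$) in which every vertex has even degree; a circuit is a $2$-regular connected graph. A subgraph $C$ of a connected graph $H$ is non-separating if $H - E(C)$ is connected. A cycle double cover (CDC) of $G$ is a set of cycles of $G$ such that every edge of $G$ lies in the edge sets of exactly two of them; a $k$-CDC is a CDC consisting of $k$ cycles. $G/E(C)$ denotes the graph obtained from $G$ by contracting all edges of $C$.
   Formalization: A 5-CDC is taken as a multiset of 5 cycles (repetitions and edgeless cycles allowed) instead of a set; with distinct cycles the claim fails, e.g. for G a circuit and C a single vertex of it. *)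

theory Defs
  imports "HOL-Library.Multiset" "HOL-Library.Uprod" "Graph_Theory.Digraph"
begin

text \<open>
  Undirected multigraphs: every edge has an unordered pair of ends, and a loop at \<open>v\<close> is an edge
  whose ends are \<open>Upair v v\<close>.
\<close>

record ('v, 'e) mgraph =
  mverts :: "'v set"
  medges :: "'e set"
  mends :: "'e \<Rightarrow> 'v uprod"

definition fin_mgraph :: "('v, 'e) mgraph \<Rightarrow> bool" where
  "fin_mgraph G \<longleftrightarrow> finite (mverts G) \<and> finite (medges G) \<and>
     (\<forall>e\<in>medges G. set_uprod (mends G e) \<subseteq> mverts G)"

text \<open>As in the digraph library, a subgraph shares the total incidence function of its host.\<close>

definition msubgraph :: "('v, 'e) mgraph \<Rightarrow> ('v, 'e) mgraph \<Rightarrow> bool" where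
  "msubgraph H G \<longleftrightarrow> fin_mgraph H \<and> mverts H \<subseteq> mverts G \<and> medges H \<subseteq> medges G \<and> mends H = mends G"

text \<open>Loops are counted twice.\<close>

definition mdegree :: "('v, 'e) mgraph \<Rightarrow> 'v \<Rightarrow> nat" where
  "mdegree G v = card {e \<in> medges G. v \<in> set_uprod (mends G e)}
               + card {e \<in> medges G. mends G e = Upair v v}"

definition mcycle :: "('v, 'e) mgraph \<Rightarrow> bool" where
  "mcycle H \<longleftrightarrow> fin_mgraph H \<and> (\<forall>v\<in>mverts H. even (mdegree H v))"

definition cycle_of :: "('v, 'e) mgraph \<Rightarrow> ('v, 'e) mgraph \<Rightarrow> bool" where
  "cycle_of C G \<longleftrightarrow> msubgraph C G \<and> mcycle C"

definition edges_reach :: "('v, 'e) mgraph \<Rightarrow> 'e set \<Rightarrow> ('v \<times> 'v) set" where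
  "edges_reach G F = {(u, v). \<exists>e\<in>F. mends G e = Upair u v}\<^sup>*"

definition mconnected :: "('v, 'e) mgraph \<Rightarrow> bool" where
  "mconnected G \<longleftrightarrow> mverts G \<noteq> {} \<and>
     (\<forall>u\<in>mverts G. \<forall>v\<in>mverts G. (u, v) \<in> edges_reach G (medges G))"

definition del_medges :: "('v, 'e) mgraph \<Rightarrow> 'e set \<Rightarrow> ('v, 'e) mgraph" where
  "del_medges G F = G\<lparr>medges := medges G - F\<rparr>"

definition edge_connected :: "nat \<Rightarrow> ('v, 'e) mgraph \<Rightarrow> bool" where
  "edge_connected k G \<longleftrightarrow> (\<forall>F\<subseteq>medges G. card F < k \<longrightarrow> mconnected (del_medges G F))"

definition non_separating :: "('v, 'e) mgraph \<Rightarrow> ('v, 'e) mgraph \<Rightarrow> bool" where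
  "non_separating C H \<longleftrightarrow> mconnected (del_medges H (medges C))"

text \<open>
  The vertices of the contraction are the vertex sets of the components of the spanning subgraph
  with edge set \<open>F\<close>.  Edges outside \<open>F\<close> whose ends get identified remain as loops.
\<close>

definition contract_class :: "('v, 'e) mgraph \<Rightarrow> 'e set \<Rightarrow> 'v \<Rightarrow> 'v set" where
  "contract_class G F v = {w \<in> mverts G. (v, w) \<in> edges_reach G F}"

definition contract :: "('v, 'e) mgraph \<Rightarrow> 'e set \<Rightarrow> ('v set, 'e) mgraph" where
  "contract G F = \<lparr> mverts = contract_class G F ` mverts G,
                    medges = medges G - F,
                    mends = (\<lambda>e. map_uprod (contract_class G F) (mends G e)) \<rparr>"

definition orientation_of :: "('v, 'e) pre_digraph \<Rightarrow> ('v, 'e) mgraph \<Rightarrow> bool" where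
  "orientation_of D G \<longleftrightarrow> verts D = mverts G \<and> arcs D = medges G \<and>
     (\<forall>e\<in>medges G. mends G e = Upair (tail D e) (head D e))"

definition has_nowhere_zero_flow :: "nat \<Rightarrow> ('v, 'e) mgraph \<Rightarrow> bool" where
  "has_nowhere_zero_flow k G \<longleftrightarrow>
     (\<exists>(D :: ('v, 'e) pre_digraph) (f :: 'e \<Rightarrow> int). orientation_of D G \<and>
        (\<forall>v\<in>mverts G. (\<Sum>e\<in>out_arcs D v. f e) = (\<Sum>e\<in>in_arcs D v. f e)) \<and>
        (\<forall>e\<in>medges G. 0 < \<bar>f e\<bar> \<and> \<bar>f e\<bar> < int k))"

text \<open>
  Cycles of a double cover are counted with multiplicity: a circuit, for instance, is doubly
  covered only by taking it twice.  Edgeless cycles are allowed as members.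
\<close>

definition CDC :: "('v, 'e) mgraph \<Rightarrow> ('v, 'e) mgraph multiset \<Rightarrow> bool" where
  "CDC G S \<longleftrightarrow> (\<forall>X\<in>#S. cycle_of X G) \<and>
     (\<forall>e\<in>medges G. size {#X \<in># S. e \<in> medges X#} = 2)"

definition k_CDC :: "nat \<Rightarrow> ('v, 'e) mgraph \<Rightarrow> ('v, 'e) mgraph multiset \<Rightarrow> bool" where
  "k_CDC k G S \<longleftrightarrow> CDC G S \<and> size S = k"

end

theory Submission imports Defs begin

text \<open>
  Let \<open>f\<close> be the given flow, read as a function on the edges outside \<open>C\<close>. It sums to zero over every
  cut that \<open>C\<close> does not meet. Hence the edges with odd \<open>f\<close> meet such cuts evenly, and they extend
  by edges of \<open>C\<close> to an even edge set \<open>A\<close>. A cut that meets neither \<open>C\<close> nor \<open>A\<close> consists of edges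
  with \<open>f = 2\<close> or \<open>f = -2\<close>, so it has even size, and these edges extend by edges of \<open>A \<union> C\<close> to an
  even edge set \<open>B\<close>. Thus \<open>A \<union> B\<close> covers everything outside \<open>C\<close>. As \<open>G - E(C)\<close> is connected, the set
  \<open>C - (A \<union> B)\<close> extends by edges outside \<open>C\<close> to an even edge set \<open>X\<close>. Then \<open>C\<close>, \<open>X\<close>, \<open>X + B + C\<close>,
  \<open>X + A + C\<close>, \<open>X + A + B + C\<close> (symmetric differences) cover every edge exactly twice.
\<close>

section \<open>Degree parities of edge sets\<close>

text \<open>Degrees are taken over bare edge sets, so that even sets can be combined by symmetric
  difference. The order of \<open>t e\<close> and \<open>h e\<close> does not affect them, and a
  loop counts twice.\<close>

definition edeg :: "('e \<Rightarrow> 'v) \<Rightarrow> ('e \<Rightarrow> 'v) \<Rightarrow> 'e set \<Rightarrow> 'v \<Rightarrow> nat" where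
  "edeg t h X v = (\<Sum>e\<in>X. of_bool (t e = v) + of_bool (h e = v))"

lemma mdegree_eq_edeg:
  assumes "finite (medges H)" "\<And>e. e \<in> medges H \<Longrightarrow> mends H e = Upair (t e) (h e)"
  shows "mdegree H v = edeg t h (medges H) v"
proof -
  have "{e \<in> medges H. v \<in> set_uprod (mends H e)} = {e \<in> medges H. t e = v \<or> h e = v}"
    "{e \<in> medges H. mends H e = Upair v v} = {e \<in> medges H. t e = v \<and> h e = v}"
    using assms(2) by auto
  then have "mdegree H v
      = (\<Sum>e\<in>medges H.
        (if t e = v \<or> h e = v then 1 else 0) + (if t e = v \<and> h e = v then 1 else 0))"
    using assms(1) by (simp add: mdegree_def sum.distrib flip: sum.inter_filter)
  also have "\<dots> = edeg t h (medges H) v"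
    unfolding edeg_def by (intro sum.cong) auto
  finally show ?thesis .
qed

text \<open>Common edges are counted twice, so degrees add modulo 2.\<close>

lemma even_edeg_sym_diff:
  assumes "finite X" "finite Y"
  shows "even (edeg t h (sym_diff X Y) v) \<longleftrightarrow> (even (edeg t h X v) \<longleftrightarrow> even (edeg t h Y v))"
proof -
  have "edeg t h X v + edeg t h Y v = edeg t h (sym_diff X Y) v + 2 * edeg t h (X \<inter> Y) v"
  proof -
    have "edeg t h X v = edeg t h (X - Y) v + edeg t h (X \<inter> Y) v"
      "edeg t h Y v = edeg t h (Y - X) v + edeg t h (X \<inter> Y) v"
      unfolding edeg_def using sum.Int_Diff[OF assms(1), of _ Y] sum.Int_Diff[OF assms(2), of _ X]
      by (simp_all add: Int_commute add.commute)
    moreover have "edeg t h (sym_diff X Y) v = edeg t h (X - Y) v + edeg t h (Y - X) v"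
      unfolding edeg_def using assms by (intro sum.union_disjoint) auto
    ultimately show ?thesis by simp
  qed
  then have "even (edeg t h X v + edeg t h Y v) \<longleftrightarrow> even (edeg t h (sym_diff X Y) v)"
    by simp
  then show ?thesis
    by auto
qed

text \<open>Handshake argument restricted to \<open>S\<close>: an edge with both ends in
  \<open>S\<close> contributes 2, an edge with one end there contributes 1.\<close>

lemma even_sum_edeg:
  assumes "finite X" "finite S"
  shows "even (\<Sum>v\<in>S. edeg t h X v) \<longleftrightarrow> even (card {e \<in> X. (t e \<in> S) \<noteq> (h e \<in> S)})"
proof -
  have "(\<Sum>v\<in>S. edeg t h X v) = (\<Sum>e\<in>X. of_bool (t e \<in> S) + of_bool (h e \<in> S))"
    unfolding edeg_def sum.swap[of _ X S] sum.distrib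
    using assms by (simp add: of_bool_def)
  moreover have "{e \<in> X. odd (of_bool (t e \<in> S) + of_bool (h e \<in> S) :: nat)}
      = {e \<in> X. (t e \<in> S) \<noteq> (h e \<in> S)}"
    by auto
  ultimately show ?thesis
    using assms(1) by (simp add: even_sum_iff)
qed

text \<open>Adding the traversed edges one by one modulo 2 lets repeated edges cancel, so any walk
  will do. For \<open>u = v\<close> all degrees are even.\<close>

lemma path_edge_set:
  assumes "(u, v) \<in> {(a, b). \<exists>e\<in>F. Upair (t e) (h e) = Upair a b}\<^sup>*"
  shows "\<exists>P\<subseteq>F. finite P \<and> (\<forall>w. odd (edeg t h P w) \<longleftrightarrow> (w = u) \<noteq> (w = v))"
  using assms
proof (induction rule: rtrancl_induct)
  case base
  show ?case by (intro exI[of _ "{}"]) (simp add: edeg_def)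
next
  case (step b c)
  then obtain P e where P: "P \<subseteq> F" "finite P" "\<And>w. odd (edeg t h P w) \<longleftrightarrow> (w = u) \<noteq> (w = b)"
    and e: "e \<in> F" "Upair (t e) (h e) = Upair b c" by auto
  have "odd (edeg t h {e} w) \<longleftrightarrow> (w = b) \<noteq> (w = c)" for w
    using e(2) by (auto simp: edeg_def)
  then have "odd (edeg t h (sym_diff P {e}) w) \<longleftrightarrow> (w = u) \<noteq> (w = c)" for w
    using even_edeg_sym_diff[OF P(2), of "{e}" t h w] P(3)[of w] by blast
  moreover have "sym_diff P {e} \<subseteq> F" "finite (sym_diff P {e})"
    using P e by auto
  ultimately show ?case by blast
qed

text \<open>The existence of \<open>T\<close>-joins, with \<open>T\<close> given as the set of odd vertices of \<open>R\<close>.\<close>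

lemma even_extension:
  assumes "finite V" "finite F" "finite R"
    and "\<And>e. e \<in> F \<union> R \<Longrightarrow> t e \<in> V \<and> h e \<in> V"
    and "\<And>S. S \<subseteq> V \<Longrightarrow> (\<forall>e\<in>F. t e \<in> S \<longleftrightarrow> h e \<in> S)
        \<Longrightarrow> even (card {e \<in> R. (t e \<in> S) \<noteq> (h e \<in> S)})"
  shows "\<exists>J\<subseteq>F. \<forall>v. even (edeg t h (sym_diff R J) v)"
  using assms(3-5)
\<comment> \<open>Each round removes two odd vertices of \<open>R\<close>.\<close>
proof (induction "card {v \<in> V. odd (edeg t h R v)}" arbitrary: R rule: less_induct)
  case less
  define T where "T = {v \<in> V. odd (edeg t h R v)}"
  show ?case
  proof (cases "T = {}")
    case True
    have "even (edeg t h R v)" for v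
    proof (cases "v \<in> V")
      case False
      then have "edeg t h R v = 0"
        unfolding edeg_def using False less.prems(2) by (intro sum.neutral) auto
      then show ?thesis by simp
    qed (use True T_def in auto)
    then show ?thesis by (intro exI[of _ "{}"]) simp
  next
    case False
    then obtain v where v: "v \<in> T" by auto
    let ?r = "{(a, b). \<exists>e\<in>F. Upair (t e) (h e) = Upair a b}"
    \<comment> \<open>The component of \<open>v\<close> in the graph with edge set \<open>F\<close>:
      no edge of \<open>F\<close> leaves it, so \<open>R\<close> crosses its boundary
      evenly.\<close>
    define S where "S = {w \<in> V. (v, w) \<in> ?r\<^sup>*}"
    have S: "S \<subseteq> V" "finite S" "v \<in> S"
      using assms(1) v by (auto simp: S_def T_def)
    have "t e \<in> S \<longleftrightarrow> h e \<in> S" if "e \<in> F" for e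
    proof -
      have "(t e, h e) \<in> ?r" "(h e, t e) \<in> ?r"
        using that by auto
      moreover have "t e \<in> V" "h e \<in> V"
        using that less.prems(2) by auto
      ultimately show ?thesis
        unfolding S_def by (auto intro: rtrancl_into_rtrancl)
    qed
    then have "even (\<Sum>w\<in>S. edeg t h R w)"
      using less.prems(1,3) S by (simp add: even_sum_edeg)
    \<comment> \<open>The component has an even number of odd vertices. As \<open>v\<close> is one
      of them, there is a second one.\<close>
    then have "even (card {w \<in> S. odd (edeg t h R w)})"
      using S(2) by (simp add: even_sum_iff)
    moreover have "card {v} = 1" by simp
    ultimately have "{w \<in> S. odd (edeg t h R w)} \<noteq> {v}"
      by (metis odd_one)
    moreover have "v \<in> {w \<in> S. odd (edeg t h R w)}"
      using v S by (simp add: T_def)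
    ultimately obtain u where u: "u \<in> S" "odd (edeg t h R u)" "u \<noteq> v"
      by blast
    obtain P where P: "P \<subseteq> F" "finite P"
      "\<And>w. odd (edeg t h P w) \<longleftrightarrow> (w = v) \<noteq> (w = u)"
      using path_edge_set[of v u F t h] u(1) by (auto simp: S_def)
    \<comment> \<open>Adding the path modulo 2 flips the parity at \<open>u\<close> and
      \<open>v\<close> only.\<close>
    define R' where "R' = sym_diff R P"
    have R'_odd: "odd (edeg t h R' w) \<longleftrightarrow> odd (edeg t h R w) \<and> w \<noteq> u \<and> w \<noteq> v" for w
      using even_edeg_sym_diff[OF less.prems(1) P(2), of t h w] P(3)[of w] u v
      by (auto simp: R'_def T_def)
    have "{v \<in> V. odd (edeg t h R' v)} \<subset> {v \<in> V. odd (edeg t h R v)}"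
      using R'_odd v unfolding T_def by blast
    then have smaller: "card {v \<in> V. odd (edeg t h R' v)} < card {v \<in> V. odd (edeg t h R v)}"
      using assms(1) by (intro psubset_card_mono) auto
    have "\<exists>J\<subseteq>F. \<forall>v. even (edeg t h (sym_diff R' J) v)"
    proof (rule less.hyps[OF smaller])
      show "finite R'" using less.prems(1) P(2) by (simp add: R'_def)
      show "t e \<in> V \<and> h e \<in> V" if "e \<in> F \<union> R'" for e
        using that less.prems(2) P(1) by (auto simp: R'_def)
      \<comment> \<open>Edges of \<open>P\<close> lie in \<open>F\<close> and do not cross such an
        \<open>S\<close>, so the cut condition survives.\<close>
      fix S assume S: "S \<subseteq> V" "\<forall>e\<in>F. t e \<in> S \<longleftrightarrow> h e \<in> S"
      then have "{e \<in> R'. (t e \<in> S) \<noteq> (h e \<in> S)} = {e \<in> R. (t e \<in> S) \<noteq> (h e \<in> S)}"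
        using P(1) by (auto simp: R'_def)
      then show "even (card {e \<in> R'. (t e \<in> S) \<noteq> (h e \<in> S)})"
        using less.prems(3)[OF S] by simp
    qed
    then obtain J where J: "J \<subseteq> F" "\<And>v. even (edeg t h (sym_diff R' J) v)"
      by blast
    have "sym_diff R (sym_diff P J) = sym_diff R' J"
      by (auto simp: R'_def)
    then show ?thesis
      using J P(1) by (intro exI[of _ "sym_diff P J"]) auto
  qed
qed

section \<open>Flows of the contraction as cut conditions in the graph\<close>

lemma contract_class_eq_reach:
  assumes "w \<in> mverts G" "contract_class G F v = contract_class G F w"
  shows "(v, w) \<in> edges_reach G F"
proof -
  have "w \<in> contract_class G F w"
    using assms(1) by (simp add: contract_class_def edges_reach_def)
  then show ?thesis
    using assms(2) by (auto simp: contract_class_def)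
qed

lemma reach_closed:
  assumes "(a, b) \<in> edges_reach G F" "a \<in> S"
    and "\<And>e. mends G e = Upair (t e) (h e)" "\<forall>e\<in>F. t e \<in> S \<longleftrightarrow> h e \<in> S"
  shows "b \<in> S"
  using assms(1) unfolding edges_reach_def
  by (induction rule: rtrancl_induct) (use assms(2-4) in auto)

text \<open>A vertex set that no edge of \<open>F\<close> leaves is a union of contracted classes.
  Summing conservation over these classes gives the cut equation in \<open>G\<close>, with no flow
  values on \<open>F\<close>.\<close>

lemma contract_flow_cuts:
  assumes "fin_mgraph G" "has_nowhere_zero_flow k (contract G F)"
  obtains t h f where
    "\<And>e. mends G e = Upair (t e) (h e)"
    "\<And>e. e \<in> medges G - F \<Longrightarrow> 0 < \<bar>f e\<bar> \<and> \<bar>f e\<bar> < int k"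
    "\<And>S. S \<subseteq> mverts G \<Longrightarrow> \<forall>e\<in>F. t e \<in> S \<longleftrightarrow> h e \<in> S
      \<Longrightarrow> (\<Sum>e\<in>medges G - F. f e * (of_bool (t e \<in> S) - of_bool (h e \<in> S))) = 0"
proof -
  define M where "M = medges G - F"
  let ?c = "contract_class G F"
  have fin: "finite (mverts G)" "finite M"
    using assms(1) by (auto simp: fin_mgraph_def M_def)
  from assms(2) obtain D f where D: "orientation_of D (contract G F)"
    and cons: "\<And>v. v \<in> mverts G \<Longrightarrow> (\<Sum>e\<in>out_arcs D (?c v). f e) = (\<Sum>e\<in>in_arcs D (?c v). f e)"
    and f: "\<And>e. e \<in> M \<Longrightarrow> 0 < \<bar>f e\<bar> \<and> \<bar>f e\<bar> < int k"
    unfolding has_nowhere_zero_flow_def by (auto simp: contract_def M_def)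
  have arcs: "arcs D = M"
    and ends: "\<And>e. e \<in> M \<Longrightarrow> map_uprod ?c (mends G e) = Upair (tail D e) (head D e)"
    using D by (auto simp: orientation_of_def contract_def M_def)
  \<comment> \<open>The unordered ends of \<open>e\<close> are named so as to lift the orientation
    \<open>D\<close>; edges outside \<open>M\<close> are oriented arbitrarily.\<close>
  have "\<exists>a b. mends G e = Upair a b \<and> (e \<in> M \<longrightarrow> ?c a = tail D e \<and> ?c b = head D e)" for e
  proof (cases "mends G e")
    case (Upair a b)
    then show ?thesis
      using ends[of e] by (cases "e \<in> M") auto
  qed
  then obtain t h where th: "\<And>e. mends G e = Upair (t e) (h e)"
    and th_D: "\<And>e. e \<in> M \<Longrightarrow> ?c (t e) = tail D e \<and> ?c (h e) = head D e"
    by metis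
  have th_V: "t e \<in> mverts G" "h e \<in> mverts G" if "e \<in> M" for e
    using assms(1) that th[of e] by (auto simp: fin_mgraph_def M_def)
  have "(\<Sum>e\<in>M. f e * (of_bool (t e \<in> S) - of_bool (h e \<in> S))) = 0"
    if S: "S \<subseteq> mverts G" "\<forall>e\<in>F. t e \<in> S \<longleftrightarrow> h e \<in> S" for S
  proof -
    have in_S: "?c a \<in> ?c ` S \<longleftrightarrow> a \<in> S" if "a \<in> mverts G" for a
    proof
      assume "?c a \<in> ?c ` S"
      then obtain b where "b \<in> S" "?c b = ?c a" by auto
      then show "a \<in> S"
        using reach_closed[OF contract_class_eq_reach[OF that] _ th S(2)] by blast
    qed auto
    have tails: "tail D e \<in> ?c ` S \<longleftrightarrow> t e \<in> S" and heads: "head D e \<in> ?c ` S \<longleftrightarrow> h e \<in> S"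
      if "e \<in> M" for e
      using in_S th_V[OF that] th_D[OF that] by metis+
    have fin_S: "finite (?c ` S)"
      using S(1) fin(1) finite_subset by blast
    \<comment> \<open>Conservation at the classes inside \<open>S\<close>; exchanging the sums turns
      each side into a sum over edges with tail, respectively head, in \<open>S\<close>.\<close>
    have "(\<Sum>K\<in>?c ` S. \<Sum>e\<in>out_arcs D K. f e) = (\<Sum>K\<in>?c ` S. \<Sum>e\<in>in_arcs D K. f e)"
      using cons S(1) by (intro sum.cong[OF refl]) blast
    moreover have "(\<Sum>K\<in>?c ` S. \<Sum>e\<in>out_arcs D K. f e) = (\<Sum>e\<in>M. f e * of_bool (t e \<in> S))"
    proof -
      have "(\<Sum>K\<in>?c ` S. \<Sum>e\<in>out_arcs D K. f e)
          = (\<Sum>K\<in>?c ` S. \<Sum>e\<in>M. if tail D e = K then f e else 0)"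
        using fin(2) by (simp add: out_arcs_def arcs sum.inter_filter)
      also have "\<dots> = (\<Sum>e\<in>M. f e * of_bool (t e \<in> S))"
        unfolding sum.swap[of _ M] using fin_S tails by (intro sum.cong) auto
      finally show ?thesis .
    qed
    moreover have "(\<Sum>K\<in>?c ` S. \<Sum>e\<in>in_arcs D K. f e) = (\<Sum>e\<in>M. f e * of_bool (h e \<in> S))"
    proof -
      have "(\<Sum>K\<in>?c ` S. \<Sum>e\<in>in_arcs D K. f e)
          = (\<Sum>K\<in>?c ` S. \<Sum>e\<in>M. if head D e = K then f e else 0)"
        using fin(2) by (simp add: in_arcs_def arcs sum.inter_filter)
      also have "\<dots> = (\<Sum>e\<in>M. f e * of_bool (h e \<in> S))"
        unfolding sum.swap[of _ M] using fin_S heads by (intro sum.cong) auto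
      finally show ?thesis .
    qed
    ultimately show ?thesis
      by (simp add: right_diff_distrib sum_subtractf)
  qed
  then show thesis
    using that[of t h f] th f unfolding M_def by blast
qed

section \<open>From a 4-flow to two even edge sets\<close>

lemma even_cover_of_cut_flow:
  fixes f :: "'e \<Rightarrow> int"
  assumes "finite V" "finite E" "C \<subseteq> E"
    and ends: "\<And>e. e \<in> E \<Longrightarrow> t e \<in> V \<and> h e \<in> V"
    and f: "\<And>e. e \<in> E - C \<Longrightarrow> 0 < \<bar>f e\<bar> \<and> \<bar>f e\<bar> < 4"
    and cuts: "\<And>S. S \<subseteq> V \<Longrightarrow> \<forall>e\<in>C. t e \<in> S \<longleftrightarrow> h e \<in> S
      \<Longrightarrow> (\<Sum>e\<in>E - C. f e * (of_bool (t e \<in> S) - of_bool (h e \<in> S))) = 0"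
  obtains A B where "A \<subseteq> E" "B \<subseteq> E" "E - C \<subseteq> A \<union> B"
    "\<And>v. even (edeg t h A v)" "\<And>v. even (edeg t h B v)"
proof -
  define M where "M = E - C"
  have fin: "finite M" "finite C" "finite E"
    using assms(2,3) finite_subset by (auto simp: M_def)
  define R where "R = {e \<in> M. odd (f e)}"
  have "\<exists>J\<subseteq>C. \<forall>v. even (edeg t h (sym_diff R J) v)"
  proof (rule even_extension)
    fix S assume S: "S \<subseteq> V" "\<forall>e\<in>C. t e \<in> S \<longleftrightarrow> h e \<in> S"
    \<comment> \<open>The sign factor is odd exactly on the edges crossing \<open>S\<close>, so the
      odd terms belong to the crossing edges of \<open>R\<close>.\<close>
    have "even (\<Sum>e\<in>M. f e * (of_bool (t e \<in> S) - of_bool (h e \<in> S)))"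
      unfolding M_def cuts[OF S] by simp
    then have "even (card {e \<in> M. odd (f e * (of_bool (t e \<in> S) - of_bool (h e \<in> S)))})"
      by (simp only: even_sum_iff[OF fin(1)])
    moreover have "{e \<in> M. odd (f e * (of_bool (t e \<in> S) - of_bool (h e \<in> S)))}
        = {e \<in> R. (t e \<in> S) \<noteq> (h e \<in> S)}"
      by (auto simp: R_def)
    ultimately show "even (card {e \<in> R. (t e \<in> S) \<noteq> (h e \<in> S)})"
      by simp
  qed (use assms(1,3) fin ends in \<open>auto simp: R_def M_def\<close>)
  then obtain J where J: "J \<subseteq> C" "\<And>v. even (edeg t h (sym_diff R J) v)"
    by blast
  define A where "A = sym_diff R J"
  have A: "A \<subseteq> E" "R \<subseteq> A"
    using J(1) assms(3) by (auto simp: A_def R_def M_def)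
  define R2 where "R2 = M - R"
  have fin_R2: "finite R2"
    using fin(1) by (simp add: R2_def)
  have f_R2: "f e = 2 \<or> f e = -2" if "e \<in> R2" for e
  proof -
    have "even (f e)" "0 < \<bar>f e\<bar>" "\<bar>f e\<bar> < 4"
      using that f[of e] by (auto simp: R2_def R_def M_def)
    then show ?thesis by presburger
  qed
  have "\<exists>J\<subseteq>A \<union> C. \<forall>v. even (edeg t h (sym_diff R2 J) v)"
  proof (rule even_extension)
    fix S assume S: "S \<subseteq> V" "\<forall>e\<in>A \<union> C. t e \<in> S \<longleftrightarrow> h e \<in> S"
    let ?s = "\<lambda>e. of_bool (t e \<in> S) - of_bool (h e \<in> S) :: int"
    \<comment> \<open>All edges of \<open>R\<close> lie in \<open>A\<close> and do not cross
      \<open>S\<close>. On \<open>R2\<close> halving leaves values 1 and -1, so a vanishing sum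
      forces an even number of crossing edges.\<close>
    have "(\<Sum>e\<in>M. f e * ?s e) = (\<Sum>e\<in>R2. f e * ?s e)"
      using S(2) A(2) fin(1) by (intro sum.mono_neutral_right) (auto simp: R2_def)
    also have "\<dots> = 2 * (\<Sum>e\<in>R2. f e div 2 * ?s e)"
      unfolding sum_distrib_left by (intro sum.cong) (auto dest!: f_R2)
    finally have "(\<Sum>e\<in>R2. f e div 2 * ?s e) = 0"
      using cuts[OF S(1)] S(2) by (simp add: M_def)
    then have "even (\<Sum>e\<in>R2. f e div 2 * ?s e)"
      by simp
    then have "even (card {e \<in> R2. odd (f e div 2 * ?s e)})"
      by (simp only: even_sum_iff[OF fin_R2])
    moreover have "{e \<in> R2. odd (f e div 2 * ?s e)} = {e \<in> R2. (t e \<in> S) \<noteq> (h e \<in> S)}"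
      by (rule Collect_cong, rule conj_cong) (auto dest!: f_R2)
    ultimately show "even (card {e \<in> R2. (t e \<in> S) \<noteq> (h e \<in> S)})"
      by simp
  next
    show "finite (A \<union> C)" using A(1) fin finite_subset by blast
    show "t e \<in> V \<and> h e \<in> V" if "e \<in> A \<union> C \<union> R2" for e
      using that ends[of e] A(1) assms(3) by (auto simp: R2_def M_def)
  qed (use assms(1) fin in \<open>auto simp: R2_def\<close>)
  then obtain J2 where J2: "J2 \<subseteq> A \<union> C" "\<And>v. even (edeg t h (sym_diff R2 J2) v)"
    by blast
  have "sym_diff R2 J2 \<subseteq> E"
    using J2(1) A(1) assms(3) by (auto simp: R2_def M_def)
  \<comment> \<open>\<open>R2\<close> is disjoint from \<open>A\<close> and \<open>C\<close>, hence
    from \<open>J2\<close>, so it survives in the symmetric difference; the rest of \<open>M\<close>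
    is \<open>R\<close>, inside \<open>A\<close>.\<close>
  moreover have "E - C \<subseteq> A \<union> sym_diff R2 J2"
    using A(2) J2(1) by (auto simp: R2_def M_def)
  ultimately show thesis
    by (rule that[OF A(1) _ _ J(2)[folded A_def] J2(2)])
qed

section \<open>Assembling the five cycles\<close>

theorem theorem3p1:
  fixes G C :: "('v, 'e) mgraph"
  assumes "fin_mgraph G"
    and "edge_connected 2 G"
    and "cycle_of C G"
    and "non_separating C G"
    and "has_nowhere_zero_flow 4 (contract G (medges C))"
  shows "\<exists>S. k_CDC 5 G S \<and> C \<in># S"
proof -
  define V E K where "V = mverts G" and "E = medges G" and "K = medges C"
  obtain t h and f :: "'e \<Rightarrow> int" where th: "\<And>e. mends G e = Upair (t e) (h e)"
    and f: "\<And>e. e \<in> E - K \<Longrightarrow> 0 < \<bar>f e\<bar> \<and> \<bar>f e\<bar> < int 4"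
    and cuts: "\<And>S. S \<subseteq> V \<Longrightarrow> \<forall>e\<in>K. t e \<in> S \<longleftrightarrow> h e \<in> S
      \<Longrightarrow> (\<Sum>e\<in>E - K. f e * (of_bool (t e \<in> S) - of_bool (h e \<in> S))) = 0"
    using contract_flow_cuts[OF assms(1,5)] unfolding V_def E_def K_def by blast
  have C: "K \<subseteq> E" "mends C = mends G" "fin_mgraph C"
    using assms(3) by (auto simp: cycle_of_def msubgraph_def E_def K_def)
  have fin: "finite V" "finite E" "finite K"
    using assms(1) C by (auto simp: fin_mgraph_def V_def E_def K_def)
  have ends: "t e \<in> V \<and> h e \<in> V" if "e \<in> E" for e
    using assms(1) that th[of e] by (auto simp: fin_mgraph_def V_def E_def)
  have K_even: "even (edeg t h K v)" for v
  proof (cases "v \<in> mverts C")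
    case True
    have "mdegree C v = edeg t h K v"
      unfolding K_def using fin th C(2) by (intro mdegree_eq_edeg) (auto simp: K_def)
    then show ?thesis
      using True assms(3) by (auto simp: cycle_of_def mcycle_def)
  next
    case False
    \<comment> \<open>\<open>mcycle\<close> speaks only of the vertices of \<open>C\<close>; any
      other vertex meets no edge of \<open>C\<close>.\<close>
    have "t e \<noteq> v \<and> h e \<noteq> v" if "e \<in> K" for e
    proof -
      have "set_uprod (mends C e) \<subseteq> mverts C"
        using C(3) that unfolding fin_mgraph_def K_def by blast
      then show ?thesis
        using False C(2) th[of e] by auto
    qed
    then have "edeg t h K v = 0"
      by (auto simp: edeg_def)
    then show ?thesis by simp
  qed
  have f4: "\<And>e. e \<in> E - K \<Longrightarrow> 0 < \<bar>f e\<bar> \<and> \<bar>f e\<bar> < 4"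
    using f by simp
  obtain A B where AB: "A \<subseteq> E" "B \<subseteq> E" "E - K \<subseteq> A \<union> B"
    "\<And>v. even (edeg t h A v)" "\<And>v. even (edeg t h B v)"
    using even_cover_of_cut_flow[OF fin(1,2) C(1) ends f4 cuts] by blast
  have finAB: "finite A" "finite B"
    using finite_subset[OF AB(1) fin(2)] finite_subset[OF AB(2) fin(2)] by auto
  define R where "R = K - (A \<union> B)"
  have "\<exists>J\<subseteq>E - K. \<forall>v. even (edeg t h (sym_diff R J) v)"
  proof (rule even_extension)
    fix S assume S: "S \<subseteq> V" "\<forall>e\<in>E - K. t e \<in> S \<longleftrightarrow> h e \<in> S"
    have "b \<in> S" if "a \<in> S" "b \<in> V" for a b
    proof (rule reach_closed[OF _ that(1) th S(2)])
      have "(a, b) \<in> edges_reach (del_medges G K) (E - K)"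
        using assms(4) that S(1)
        by (auto simp: non_separating_def mconnected_def del_medges_def V_def E_def K_def)
      then show "(a, b) \<in> edges_reach G (E - K)"
        by (simp add: edges_reach_def del_medges_def)
    qed
    \<comment> \<open>A set that no edge outside \<open>K\<close> leaves is a union of components of
      \<open>G - E(C)\<close>, which is connected.\<close>
    then have "S = {} \<or> S = V"
      using S(1) by blast
    then have none: "{e \<in> R. (t e \<in> S) \<noteq> (h e \<in> S)} = {}"
      using ends C(1) by (auto simp: R_def)
    show "even (card {e \<in> R. (t e \<in> S) \<noteq> (h e \<in> S)})"
      unfolding none by simp
  qed (use fin C(1) ends in \<open>auto simp: R_def\<close>)
  then obtain J where J: "J \<subseteq> E - K" "\<And>v. even (edeg t h (sym_diff R J) v)"
    by blast
  define X where "X = sym_diff R J"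
  have X: "X \<subseteq> E" "finite X" "X \<inter> K = K - (A \<union> B)" "\<And>v. even (edeg t h X v)"
  proof -
    show XE: "X \<subseteq> E"
      using J(1) C(1) by (auto simp: X_def R_def)
    show "finite X"
      using XE fin(2) finite_subset by blast
  qed (use J in \<open>auto simp: X_def R_def\<close>)
  define Y where "Y = sym_diff X K"
  have Y: "Y \<subseteq> E" "finite Y" "\<And>v. even (edeg t h Y v)"
    using X C(1) fin K_even even_edeg_sym_diff[OF X(2) fin(3), of t h] by (auto simp: Y_def)
  define X2 X3 X4 where "X2 = sym_diff Y B" and "X3 = sym_diff Y A" and "X4 = sym_diff X3 B"
  have X2: "X2 \<subseteq> E" "\<And>v. even (edeg t h X2 v)"
    using Y AB even_edeg_sym_diff[OF Y(2) finAB(2), of t h] by (auto simp: X2_def)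
  have X3: "X3 \<subseteq> E" "finite X3" "\<And>v. even (edeg t h X3 v)"
    using Y AB finAB even_edeg_sym_diff[OF Y(2) finAB(1), of t h] by (auto simp: X3_def)
  have X4: "X4 \<subseteq> E" "\<And>v. even (edeg t h X4 v)"
    using X3 AB even_edeg_sym_diff[OF X3(2) finAB(2), of t h] by (auto simp: X4_def)
  \<comment> \<open>Spanning subgraphs suffice, since isolated vertices have degree 0.\<close>
  define H where "H Z = G\<lparr>medges := Z\<rparr>" for Z
  have H_edges [simp]: "medges (H Z) = Z" for Z
    by (simp add: H_def)
  have H: "cycle_of (H Z) G" if Z: "Z \<subseteq> E" "\<And>v. even (edeg t h Z v)" for Z
  proof -
    have "finite Z" using Z(1) fin(2) finite_subset by blast
    then have "mdegree (H Z) v = edeg t h Z v" for v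
      using mdegree_eq_edeg[of "H Z" t h v] th by (simp add: H_def)
    moreover have "fin_mgraph (H Z)"
      using assms(1) Z(1) \<open>finite Z\<close> by (auto simp: H_def fin_mgraph_def E_def)
    ultimately show ?thesis
      using Z by (auto simp: cycle_of_def msubgraph_def mcycle_def H_def E_def)
  qed
  define S where "S = {#C, H X, H X2, H X3, H X4#}"
  have "cycle_of Z G" if "Z \<in># S" for Z
    using that assms(3) H X X2 X3 X4 by (auto simp: S_def)
  moreover have "size {#Z \<in># S. e \<in> medges Z#} = 2" if "e \<in> medges G" for e
  proof (cases "e \<in> K")
    case True
    \<comment> \<open>Besides \<open>C\<close>, exactly one cycle contains \<open>e\<close>:
      \<open>X\<close> if \<open>e\<close> avoids \<open>A\<close> and \<open>B\<close>; otherwise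
      \<open>e\<close> is in \<open>Y\<close>, and it stays in \<open>X2\<close>, \<open>X3\<close>
      or \<open>X4\<close> according as it lies in \<open>A\<close> only, \<open>B\<close> only or
      both.\<close>
    then have "e \<in> X \<longleftrightarrow> e \<notin> A \<and> e \<notin> B"
      using X(3) by blast
    then show ?thesis
      using True by (auto simp: S_def X2_def X3_def X4_def Y_def K_def[symmetric])
  next
    case False
    \<comment> \<open>Here \<open>X\<close> and \<open>Y\<close> agree. Of \<open>A\<close>,
      \<open>B\<close> and \<open>sym_diff A B\<close> exactly two contain \<open>e\<close>, so two
      of the four membership values are flipped relative to \<open>X\<close> and two are
      not.\<close>
    then have "e \<in> A \<or> e \<in> B"
      using that AB(3) by (auto simp: E_def)
    then show ?thesis
      using False by (auto simp: S_def X2_def X3_def X4_def Y_def K_def[symmetric])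
  qed
  ultimately have "k_CDC 5 G S"
    by (simp add: k_CDC_def CDC_def S_def)
  then show ?thesis
    by (auto simp: S_def)
qed

end
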